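(* Let $G$ be a graph of order $n$ with vertex set $V(G)=\{v_1,\dots,v_n\}$ and minimum degree $\delta$, and let $\mathbf{r}=(r_1,\dots,r_n)$ and $\mathbf{s}=(s_1,\dots,s_n)$ be $n$-tuples of nonnegative integers. Put $s=\max\{s_1,\dots,s_n\}$. Let $0<c<1$ be a constant. If $s\le(1-c)\ln\delta$, then $$\gamma\langle\mathbf{r},\mathbf{s}\rangle(G)<\left(\frac{\ln\delta}{\delta+1}+\frac{s}{\delta^{0.5c^2}}\right)n .$$
   Context: All graphs are finite, undirected, without loops and multiple edges. $N[v]$ denotes the closed neighbourhood of $v$ (the neighbours of $v$ together with $v$). Let $\mathbf{N}$ denote the set of nonnegative integers. A function $f:V(G)\to\mathbf{N}$ is an $\mathbf{r}$-function of $G$ if $f(v_i)\le r_i$ for all $i=1,\dots,n$. An $\mathbf{r}$-function $f$ is $\mathbf{s}$-dominating if $\sum_{u\in N[v_i]}f(u)\ge s_i$ for all $i=1,\dots,n$. The weight of $f$ is $|f|=\sum_{i=1}^n f(v_i)$. The $\langle\mathbf{r},\mathbf{s}\rangle$-domination number $\gamma\langle\mathbf{r},\mathbf{s}\rangle(G)$ is the smallest weight of an $\mathbf{s}$-dominating $\mathbf{r}$-function of $G$ (such functions exist if and only if $\sum_{v_j\in N[v_i]}r_j\ge s_i$ for all $i=1,\dots,n$).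
   Formalization: The formal theorem additionally assumes every r_i is at least 1 (otherwise the domination number may be undefined or the bound fail) and minimum degree δ at least 2 (for δ = 0 ln δ is undefined, for δ = 1 the strict bound reads 0 < 0). *)

theory Defs
  imports "HOL-Analysis.Analysis" "Graph_Theory.Digraph"
begin

text \<open>
  Finite simple undirected graphs are the \<^locale>\<open>graph\<close>s of the library: finite symmetric
  digraphs without loops and parallel arcs, an undirected edge being a pair of opposite arcs.
  Hence the out-degree of a vertex is its number of neighbours.
  The tuples indexed by the vertices are functions on the vertex type; their values
  outside \<^term>\<open>verts G\<close> are irrelevant.
\<close>

definition closed_nbhd :: "('a, 'b) pre_digraph \<Rightarrow> 'a \<Rightarrow> 'a set" where
  "closed_nbhd G v = insert v {u. v \<rightarrow>\<^bsub>G\<^esub> u}"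

definition min_degree :: "('a, 'b) pre_digraph \<Rightarrow> nat" where
  "min_degree G = Min (out_degree G ` verts G)"

definition r_function :: "('a, 'b) pre_digraph \<Rightarrow> ('a \<Rightarrow> nat) \<Rightarrow> ('a \<Rightarrow> nat) \<Rightarrow> bool" where
  "r_function G r f \<longleftrightarrow> (\<forall>v\<in>verts G. f v \<le> r v)"

definition s_dominating :: "('a, 'b) pre_digraph \<Rightarrow> ('a \<Rightarrow> nat) \<Rightarrow> ('a \<Rightarrow> nat) \<Rightarrow> bool" where
  "s_dominating G s f \<longleftrightarrow> (\<forall>v\<in>verts G. (\<Sum>u\<in>closed_nbhd G v. f u) \<ge> s v)"

definition weight :: "('a, 'b) pre_digraph \<Rightarrow> ('a \<Rightarrow> nat) \<Rightarrow> nat" where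
  "weight G f = (\<Sum>v\<in>verts G. f v)"

text \<open>Only meaningful if an \<open>s\<close>-dominating \<open>r\<close>-function exists, see the two lemmas below.\<close>

definition rs_domination_number ::
    "('a, 'b) pre_digraph \<Rightarrow> ('a \<Rightarrow> nat) \<Rightarrow> ('a \<Rightarrow> nat) \<Rightarrow> nat" where
  "rs_domination_number G r s =
     (LEAST w. \<exists>f. r_function G r f \<and> s_dominating G s f \<and> weight G f = w)"

lemma (in graph) closed_nbhd_subset: "v \<in> verts G \<Longrightarrow> closed_nbhd G v \<subseteq> verts G"
  by (auto simp: closed_nbhd_def adj_in_verts)

lemma (in graph) s_dominating_r_function_exists_iff:
  "(\<exists>f. r_function G r f \<and> s_dominating G s f) \<longleftrightarrow>
   (\<forall>v\<in>verts G. (\<Sum>u\<in>closed_nbhd G v. r u) \<ge> s v)"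
proof
  assume "\<exists>f. r_function G r f \<and> s_dominating G s f"
  then obtain f where f: "r_function G r f" "s_dominating G s f" by blast
  show "\<forall>v\<in>verts G. (\<Sum>u\<in>closed_nbhd G v. r u) \<ge> s v"
  proof
    fix v assume v: "v \<in> verts G"
    have "s v \<le> (\<Sum>u\<in>closed_nbhd G v. f u)"
      using f(2) v by (simp add: s_dominating_def)
    also have "\<dots> \<le> (\<Sum>u\<in>closed_nbhd G v. r u)"
      using f(1) closed_nbhd_subset[OF v] by (intro sum_mono) (auto simp: r_function_def)
    finally show "(\<Sum>u\<in>closed_nbhd G v. r u) \<ge> s v" .
  qed
qed (auto simp: r_function_def s_dominating_def)

lemma rs_domination_number_attained:
  assumes "\<exists>f. r_function G r f \<and> s_dominating G s f"
  obtains f where "r_function G r f" "s_dominating G s f" "weight G f = rs_domination_number G r s"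
proof -
  have "\<exists>w f. r_function G r f \<and> s_dominating G s f \<and> weight G f = w"
    using assms by blast
  from LeastI_ex[OF this] show thesis
    using that unfolding rs_domination_number_def by blast
qed

lemma (in graph) out_degree_eq_card_neighbours: "out_degree G v = card {u. v \<rightarrow>\<^bsub>G\<^esub> u}"
proof -
  have "{u. v \<rightarrow>\<^bsub>G\<^esub> u} = head G ` out_arcs G v"
    by (force simp: arcs_ends_conv)
  moreover have "inj_on (head G) (out_arcs G v)"
    by (auto intro!: inj_onI no_multi_arcs simp: arc_to_ends_def)
  ultimately show ?thesis
    by (simp add: out_degree_def card_image)
qed

end

theory Submission
  imports Defs
begin

text \<open>
  The proof is the probabilistic method with alteration. Put \<open>k = max s\<close>, and choose a random set
  \<open>A\<close> of vertices, each vertex independently with probability \<open>p = ln \<delta> / (\<delta> + 1)\<close>. Its expected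
  size \<open>p n\<close> is the first summand of the bound. If the closed neighbourhood of \<open>v\<close> contains only
  \<open>X < s v\<close> chosen vertices, add \<open>s v - X\<close> further vertices of that neighbourhood to \<open>A\<close>; as
  \<open>k \<le> ln \<delta> < \<delta> + 1\<close>, there are enough of them. The indicator function of the repaired set is
  then \<open>s\<close>-dominating, and it is an \<open>r\<close>-function because every \<open>r v\<close> is at least \<open>1\<close>. The
  lemma \<open>multiple_hitting_set_exists\<close> carries this out for the family of closed neighbourhoods.

  The expected number of repairs at \<open>v\<close> is bounded by a Chernoff argument. With \<open>q = 1 - c\<close>, the
  truncated difference \<open>max 0 (k - X)\<close> is at most \<open>k q\<^sup>X / q\<^sup>k\<close>. The variable \<open>X\<close> is binomial with
  at least \<open>\<delta> + 1\<close> trials, so the expectation of \<open>q\<^sup>X\<close> is at most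
  \<open>(1 - c p)\<^bsup>\<delta> + 1\<^esup> \<le> \<delta>\<^bsup>-c\<^esup>\<close>, while \<open>k \<le> (1 - c) ln \<delta>\<close> controls \<open>q\<^sup>k\<close>. Together
  (\<open>chernoff_factor_less\<close>) this gives
  \<open>k \<delta>\<^bsup>-h\<^esup>\<close> with \<open>h = c + (1 - c) ln (1 - c)\<close>, and \<open>h > c\<^sup>2 / 2\<close>.

  The strict inequality comes from the last step and needs \<open>k > 0\<close>. If \<open>k = 0\<close>, the zero
  function is dominating and the bound is positive.
\<close>

section \<open>Random subsets of a finite set\<close>

text \<open>The probability of \<open>A\<close> as an outcome of independent choices of the elements of \<open>V\<close>.\<close>

definition bernoulli_weight :: "real \<Rightarrow> 'a set \<Rightarrow> 'a set \<Rightarrow> real" where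
  "bernoulli_weight p V A = p ^ card A * (1 - p) ^ card (V - A)"

lemma bernoulli_weight_nonneg:
  "0 \<le> p \<Longrightarrow> p \<le> 1 \<Longrightarrow> 0 \<le> bernoulli_weight p V A"
  by (simp add: bernoulli_weight_def)

text \<open>
  This is the probability generating function of a binomial variable. Evaluated at \<open>t = 1\<close> it gives
  the total mass, at \<open>t = 0\<close> the probability that \<open>N\<close> is missed, and for \<open>t\<close> strictly between
  them the Chernoff bound. It holds because both sides evaluate the same product over \<open>V\<close>
  in which \<open>p\<close> is multiplied by \<open>t\<close> at the elements of \<open>N\<close>.
\<close>

lemma sum_bernoulli_weight_power_card_Int:
  assumes V: "finite V" and N: "N \<subseteq> V"
  shows "(\<Sum>A\<in>Pow V. bernoulli_weight p V A * t ^ card (A \<inter> N)) = (1 - (1 - t) * p) ^ card N"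
proof -
  \<comment> \<open>The indicator of membership in \<open>N\<close>, exponentiated to base \<open>t\<close>.\<close>
  define g where "g x = (if x \<in> N then t else 1)" for x
  have prod_g: "(\<Prod>x\<in>A. g x) = t ^ card (A \<inter> N)" if "A \<subseteq> V" for A
    using finite_subset[OF that V] by (simp add: g_def prod.If_cases)
  have "(\<Sum>A\<in>Pow V. bernoulli_weight p V A * t ^ card (A \<inter> N))
      = (\<Sum>A\<in>Pow V. (\<Prod>x\<in>A. p * g x) * (\<Prod>x\<in>V - A. 1 - p))"
    by (intro sum.cong) (auto simp: bernoulli_weight_def prod.distrib prod_g)
  also have "\<dots> = (\<Prod>x\<in>V. p * g x + (1 - p))"
    by (rule prod_add[OF V, symmetric])
  also have "\<dots> = (\<Prod>x\<in>V. if x \<in> N then 1 - (1 - t) * p else 1)"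
    by (intro prod.cong) (auto simp: g_def algebra_simps)
  also have "\<dots> = (1 - (1 - t) * p) ^ card N"
    using N V by (simp add: prod.If_cases Int_absorb1)
  finally show ?thesis .
qed

lemma sum_bernoulli_weight:
  assumes "finite V"
  shows "(\<Sum>A\<in>Pow V. bernoulli_weight p V A) = 1"
  using sum_bernoulli_weight_power_card_Int[OF assms empty_subsetI, of p 1] by simp

text \<open>
  Since \<open>0 ^ card (A \<inter> {x})\<close> indicates that \<open>x\<close> is missed, the generating function yields the
  expected size of the complement of \<open>A\<close>.
\<close>

lemma sum_bernoulli_weight_card:
  assumes V: "finite V"
  shows "(\<Sum>A\<in>Pow V. bernoulli_weight p V A * real (card A)) = p * real (card V)"
proof -
  have card_eq: "real (card A) = real (card V) - (\<Sum>x\<in>V. 0 ^ card (A \<inter> {x}))" if "A \<subseteq> V" for A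
  proof -
    have "(\<Sum>x\<in>V. (0::real) ^ card (A \<inter> {x})) = (\<Sum>x\<in>V. if x \<in> A then 0 else 1)"
      by (intro sum.cong) auto
    also have "\<dots> = real (card (V - A))"
      using V by (simp add: sum.If_cases Diff_eq)
    also have "\<dots> = real (card V) - real (card A)"
      using that V finite_subset[OF that V] by (simp add: card_Diff_subset card_mono of_nat_diff)
    finally show ?thesis by simp
  qed
  have "(\<Sum>A\<in>Pow V. bernoulli_weight p V A * real (card A))
      = (\<Sum>A\<in>Pow V. bernoulli_weight p V A * (real (card V) - (\<Sum>x\<in>V. 0 ^ card (A \<inter> {x}))))"
    by (intro sum.cong arg_cong2[of _ _ _ _ "(*)"] card_eq) auto
  also have "\<dots> = real (card V) * (\<Sum>A\<in>Pow V. bernoulli_weight p V A)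
        - (\<Sum>A\<in>Pow V. \<Sum>x\<in>V. bernoulli_weight p V A * 0 ^ card (A \<inter> {x}))"
    by (simp add: right_diff_distrib sum_subtractf sum_distrib_left mult.commute)
  also have "(\<Sum>A\<in>Pow V. \<Sum>x\<in>V. bernoulli_weight p V A * 0 ^ card (A \<inter> {x}))
      = (\<Sum>x\<in>V. \<Sum>A\<in>Pow V. bernoulli_weight p V A * 0 ^ card (A \<inter> {x}))"
    by (rule sum.swap)
  also have "\<dots> = (\<Sum>x\<in>V. 1 - p)"
    using V by (intro sum.cong refl) (subst sum_bernoulli_weight_power_card_Int, auto)
  finally show ?thesis
    by (simp add: sum_bernoulli_weight[OF V] algebra_simps)
qed

lemma exists_subset_le_expectation:
  fixes f :: "'a set \<Rightarrow> real"
  assumes V: "finite V" and p: "0 \<le> p" "p \<le> 1"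
    and le: "(\<Sum>A\<in>Pow V. bernoulli_weight p V A * f A) \<le> b"
  shows "\<exists>A\<subseteq>V. f A \<le> b"
proof (rule ccontr)
  assume "\<not> ?thesis"
  then have gt: "b < f A" if "A \<subseteq> V" for A
    using that by (auto simp: not_le)
  have nonneg: "0 \<le> bernoulli_weight p V A * (f A - b)" if "A \<subseteq> V" for A
    using gt[OF that] bernoulli_weight_nonneg[OF p, of V A] by simp
  have "(\<Sum>A\<in>Pow V. bernoulli_weight p V A * (f A - b)) \<le> 0"
    using le by (simp add: right_diff_distrib sum_subtractf sum_bernoulli_weight[OF V]
        flip: sum_distrib_right)
  then have "(\<Sum>A\<in>Pow V. bernoulli_weight p V A * (f A - b)) = 0"
    using nonneg by (intro antisym sum_nonneg) auto
  then have zero: "bernoulli_weight p V A * (f A - b) = 0" if "A \<subseteq> V" for A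
    using nonneg V that by (subst (asm) sum_nonneg_eq_0_iff) auto
  have "bernoulli_weight p V A = 0" if "A \<subseteq> V" for A
    using zero[OF that] gt[OF that] by simp
  then have "(\<Sum>A\<in>Pow V. bernoulli_weight p V A) = 0"
    by (intro sum.neutral) auto
  then show False
    by (simp add: sum_bernoulli_weight[OF V])
qed

section \<open>Multiple hitting sets by alteration\<close>

text \<open>
  Each deficit is filled separately, so the repairs may overlap and the union bound on their sizes
  is all that is claimed.
\<close>

lemma repair_to_multiple_hitting_set:
  fixes N :: "'i \<Rightarrow> 'a set" and k :: "'i \<Rightarrow> nat"
  assumes I: "finite I" and A: "finite A"
    and N: "\<And>i. i \<in> I \<Longrightarrow> finite (N i)" "\<And>i. i \<in> I \<Longrightarrow> k i \<le> card (N i)"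
  obtains D where "A \<subseteq> D" "D \<subseteq> A \<union> (\<Union>i\<in>I. N i)"
    and "\<forall>i\<in>I. k i \<le> card (D \<inter> N i)"
    and "card D \<le> card A + (\<Sum>i\<in>I. k i - card (A \<inter> N i))"
proof -
  have "\<exists>T\<subseteq>N i - A. card T = k i - card (A \<inter> N i)" if "i \<in> I" for i
  proof -
    have "card (N i) = card (A \<inter> N i) + card (N i - A)"
      using N(1)[OF that] by (subst card_Un_disjoint[symmetric]) (auto intro: arg_cong[of _ _ card])
    then have "k i - card (A \<inter> N i) \<le> card (N i - A)"
      using N(2)[OF that] by linarith
    then show ?thesis
      by (meson obtain_subset_with_card_n)
  qed
  then obtain T where T: "\<And>i. i \<in> I \<Longrightarrow> T i \<subseteq> N i - A"
      "\<And>i. i \<in> I \<Longrightarrow> card (T i) = k i - card (A \<inter> N i)"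
    by metis
  have fin_T: "finite (T i)" if "i \<in> I" for i
    using T(1)[OF that] N(1)[OF that] by (meson finite_Diff finite_subset)
  define D where "D = A \<union> (\<Union>i\<in>I. T i)"
  have fin_D: "finite D"
    using I A fin_T by (simp add: D_def)
  show thesis
  proof (rule that)
    show "A \<subseteq> D" "D \<subseteq> A \<union> (\<Union>i\<in>I. N i)"
      using T(1) by (auto simp: D_def)
    show "\<forall>i\<in>I. k i \<le> card (D \<inter> N i)"
    proof
      fix i assume i: "i \<in> I"
      have "k i \<le> card (A \<inter> N i) + card (T i)"
        using T(2)[OF i] by simp
      also have "\<dots> = card ((A \<inter> N i) \<union> T i)"
        using T(1)[OF i] fin_T[OF i] A by (intro card_Un_disjoint[symmetric]) auto
      also have "\<dots> \<le> card (D \<inter> N i)"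
        using T(1)[OF i] fin_D i by (intro card_mono) (auto simp: D_def)
      finally show "k i \<le> card (D \<inter> N i)" .
    qed
    have "card D \<le> card A + card (\<Union>i\<in>I. T i)"
      unfolding D_def by (rule card_Un_le)
    also have "card (\<Union>i\<in>I. T i) \<le> (\<Sum>i\<in>I. card (T i))"
      by (rule card_UN_le[OF I])
    also have "\<dots> = (\<Sum>i\<in>I. k i - card (A \<inter> N i))"
      using T(2) by simp
    finally show "card D \<le> card A + (\<Sum>i\<in>I. k i - card (A \<inter> N i))" by simp
  qed
qed

text \<open>
  An exponential majorant of the truncated difference: if \<open>x < k\<close>, then \<open>q ^ x \<ge> q ^ k\<close>.
  Its expectation is accessible through the generating function.
\<close>

lemma truncated_diff_le_power:
  fixes q :: real
  assumes "0 < q" "q \<le> 1"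
  shows "real (k - x) \<le> real k / q ^ k * q ^ x"
proof (cases "x < k")
  case True
  have "real (k - x) * q ^ k \<le> real k * q ^ x"
    using True assms by (intro mult_mono power_decreasing) auto
  then show ?thesis
    using assms by (simp add: field_simps)
next
  case False
  then show ?thesis using assms by simp
qed

text \<open>
  The alteration method: the summand \<open>p\<close> accounts for the expected size of the random set, and the
  other summand bounds the expected number of repairs at each member of the family.
  The parameter \<open>q\<close> is the exponential tilt of the Chernoff bound, to be chosen according
  to \<open>k\<close> and \<open>m * p\<close>.
\<close>

lemma multiple_hitting_set_exists:
  fixes N :: "'a \<Rightarrow> 'a set" and s :: "'a \<Rightarrow> nat" and p q :: real
  assumes V: "finite V" and N: "\<And>v. v \<in> V \<Longrightarrow> N v \<subseteq> V"
    and m: "\<And>v. v \<in> V \<Longrightarrow> m \<le> card (N v)"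
    and s: "\<And>v. v \<in> V \<Longrightarrow> s v \<le> k" and km: "k \<le> m"
    and p: "0 \<le> p" "p \<le> 1" and q: "0 < q" "q \<le> 1"
  obtains D where "D \<subseteq> V" "\<forall>v\<in>V. s v \<le> card (D \<inter> N v)"
    and "real (card D) \<le> (p + real k / q ^ k * (1 - (1 - q) * p) ^ m) * real (card V)"
proof -
  define w where "w = bernoulli_weight p V"
  \<comment> \<open>The size of \<open>A\<close> together with the exponential majorants of the deficits.\<close>
  define cost where "cost A = real (card A) + (\<Sum>v\<in>V. real k / q ^ k * q ^ card (A \<inter> N v))" for A
  have base: "0 \<le> 1 - (1 - q) * p" "1 - (1 - q) * p \<le> 1"
    using p q mult_mono[of "1 - q" 1 p 1] by auto
  have "(\<Sum>A\<in>Pow V. w A * cost A)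
      = p * real (card V) + (\<Sum>A\<in>Pow V. \<Sum>v\<in>V. real k / q ^ k * (w A * q ^ card (A \<inter> N v)))"
    using sum_bernoulli_weight_card[OF V, of p]
    by (simp add: w_def cost_def distrib_left sum.distrib sum_distrib_left mult_ac)
  also have "(\<Sum>A\<in>Pow V. \<Sum>v\<in>V. real k / q ^ k * (w A * q ^ card (A \<inter> N v)))
      = (\<Sum>v\<in>V. real k / q ^ k * (\<Sum>A\<in>Pow V. w A * q ^ card (A \<inter> N v)))"
    by (subst sum.swap) (simp only: sum_distrib_left)
  also have "\<dots> = (\<Sum>v\<in>V. real k / q ^ k * (1 - (1 - q) * p) ^ card (N v))"
    using N by (simp add: w_def sum_bernoulli_weight_power_card_Int[OF V])
  also have "\<dots> \<le> (\<Sum>v\<in>V. real k / q ^ k * (1 - (1 - q) * p) ^ m)"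
    using m base q by (intro sum_mono mult_left_mono power_decreasing) auto
  finally have "(\<Sum>A\<in>Pow V. w A * cost A)
      \<le> (p + real k / q ^ k * (1 - (1 - q) * p) ^ m) * real (card V)"
    by (simp add: algebra_simps)
  then obtain A where A: "A \<subseteq> V"
      "cost A \<le> (p + real k / q ^ k * (1 - (1 - q) * p) ^ m) * real (card V)"
    using exists_subset_le_expectation[OF V p] unfolding w_def by blast
  have enough: "s v \<le> card (N v)" if "v \<in> V" for v
    using s[OF that] m[OF that] km by linarith
  obtain D where D: "A \<subseteq> D" "D \<subseteq> A \<union> (\<Union>v\<in>V. N v)" "\<forall>v\<in>V. s v \<le> card (D \<inter> N v)"
      "card D \<le> card A + (\<Sum>v\<in>V. s v - card (A \<inter> N v))"
    by (rule repair_to_multiple_hitting_set[OF V finite_subset[OF A(1) V]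
          finite_subset[OF N V] enough])
  have "real (card D) \<le> real (card A) + (\<Sum>v\<in>V. real (s v - card (A \<inter> N v)))"
    using D(4) by (simp flip: of_nat_sum of_nat_add)
  also have "\<dots> \<le> cost A"
    unfolding cost_def
  proof (intro add_left_mono sum_mono)
    fix v assume v: "v \<in> V"
    have "real (s v - card (A \<inter> N v)) \<le> real (k - card (A \<inter> N v))"
      using s[OF v] by simp
    also have "\<dots> \<le> real k / q ^ k * q ^ card (A \<inter> N v)"
      by (rule truncated_diff_le_power[OF q])
    finally show "real (s v - card (A \<inter> N v)) \<le> real k / q ^ k * q ^ card (A \<inter> N v)" .
  qed
  also note A(2)
  finally have "real (card D) \<le> (p + real k / q ^ k * (1 - (1 - q) * p) ^ m) * real (card V)" .
  moreover have "D \<subseteq> V"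
    using D(2) A(1) N by blast
  ultimately show thesis
    using D(3) that by blast
qed

section \<open>The exponent in the Chernoff bound\<close>

text \<open>
  Both sides agree at \<open>c = 0\<close>, and the derivative of their difference is \<open>- ln (1 - c) - c\<close>, which is
  positive for \<open>0 < c < 1\<close> by strict concavity of the logarithm.
\<close>

lemma half_square_less_chernoff_exponent:
  fixes c :: real
  assumes "0 < c" "c < 1"
  shows "c\<^sup>2 / 2 < c + (1 - c) * ln (1 - c)"
proof -
  define h where "h x = x + (1 - x) * ln (1 - x) - 1 / 2 * x\<^sup>2" for x :: real
  have "h 0 < h c"
  proof (rule DERIV_pos_imp_increasing_open[OF assms(1)])
    fix x assume x: "0 < x" "x < c"
    have "(h has_real_derivative - ln (1 - x) - x) (at x)"
      unfolding h_def using x assms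
      by (auto intro!: derivative_eq_intros)
    moreover have "ln (1 - x) < - x"
      using x assms ln_le_minus_one[of "1 - x"] ln_eq_minus_one[of "1 - x"] by fastforce
    ultimately show "\<exists>y. (h has_real_derivative y) (at x) \<and> 0 < y"
      by (intro exI[of _ "- ln (1 - x) - x"]) auto
  next
    show "continuous_on {0..c} h"
      unfolding h_def using assms by (intro continuous_intros) auto
  qed
  then show ?thesis by (simp add: h_def)
qed

text \<open>
  The bound for the repairs at the values of the parameters used below, namely \<open>q = 1 - c\<close> and \<open>p\<close>
  such that \<open>m p = ln d\<close>.
\<close>

lemma chernoff_factor_less:
  fixes c d :: real
  assumes c: "0 < c" "c < 1" and d: "1 < d" and m: "0 < m" "ln d \<le> real m"
    and k: "real k \<le> (1 - c) * ln d"
  shows "(1 - c * (ln d / real m)) ^ m / (1 - c) ^ k < 1 / d powr (c\<^sup>2 / 2)"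
proof -
  have ln_d: "0 < ln d" using d by simp
  have "(1 - c * (ln d / real m)) ^ m = (1 - c * ln d / real m) ^ m" by simp
  also have "\<dots> \<le> exp (- (c * ln d))"
    using c m ln_d mult_mono[of c 1 "ln d" "real m"]
    by (intro exp_ge_one_minus_x_over_n_power_n) auto
  finally have num: "(1 - c * (ln d / real m)) ^ m \<le> exp (- (c * ln d))" .
  have "(1 - c) * ln d * ln (1 - c) \<le> real k * ln (1 - c)"
    using k c by (intro mult_right_mono_neg) auto
  then have "exp ((1 - c) * ln d * ln (1 - c)) \<le> exp (real k * ln (1 - c))"
    by simp
  also have "\<dots> = (1 - c) ^ k"
    using c by (simp add: exp_of_nat_mult)
  finally have den: "exp ((1 - c) * ln d * ln (1 - c)) \<le> (1 - c) ^ k" .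
  have "(1 - c * (ln d / real m)) ^ m / (1 - c) ^ k
      \<le> exp (- (c * ln d)) / exp ((1 - c) * ln d * ln (1 - c))"
    by (intro frac_le num den) auto
  also have "\<dots> = exp (- ((c + (1 - c) * ln (1 - c)) * ln d))"
    by (simp add: algebra_simps flip: exp_diff)
  also have "\<dots> < exp (- (c\<^sup>2 / 2 * ln d))"
    using half_square_less_chernoff_exponent[OF c] ln_d by simp
  also have "\<dots> = 1 / d powr (c\<^sup>2 / 2)"
    using d by (simp add: powr_def exp_minus field_simps)
  finally show ?thesis .
qed

section \<open>Domination\<close>

lemma (in graph) card_closed_nbhd: "card (closed_nbhd G v) = out_degree G v + 1"
proof -
  have "{u. v \<rightarrow>\<^bsub>G\<^esub> u} \<subseteq> verts G"
    by (auto simp: adj_in_verts)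
  then have "finite {u. v \<rightarrow>\<^bsub>G\<^esub> u}"
    by (rule finite_subset) simp
  moreover have "v \<notin> {u. v \<rightarrow>\<^bsub>G\<^esub> u}"
    using adj_not_same by auto
  ultimately show ?thesis
    by (simp add: closed_nbhd_def out_degree_eq_card_neighbours)
qed

lemma (in graph) rs_domination_number_le_card:
  assumes D: "D \<subseteq> verts G" and r: "\<forall>v\<in>verts G. 1 \<le> r v"
    and dom: "\<forall>v\<in>verts G. s v \<le> card (D \<inter> closed_nbhd G v)"
  shows "rs_domination_number G r s \<le> card D"
proof -
  define f :: "'a \<Rightarrow> nat" where "f u = of_bool (u \<in> D)" for u
  have sum_f: "sum f S = card (D \<inter> S)" if "S \<subseteq> verts G" for S
    using finite_subset[OF that finite_verts] by (simp add: f_def of_bool_def sum.If_cases Int_commute)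
  have "r_function G r f"
    using r by (auto simp: r_function_def f_def of_bool_def)
  moreover have "s_dominating G s f"
    using dom closed_nbhd_subset by (simp add: s_dominating_def sum_f)
  moreover have "weight G f = card D"
    using D by (simp add: weight_def sum_f Int_absorb2)
  ultimately show ?thesis
    unfolding rs_domination_number_def by (intro Least_le) blast
qed

theorem theorem14:
  fixes G :: "('a, 'b) pre_digraph" and r s :: "'a \<Rightarrow> nat" and c :: real
  assumes "graph G" and "verts G \<noteq> {}"
    and "min_degree G \<ge> 2"
    and "\<forall>v\<in>verts G. r v \<ge> 1"
    and "0 < c" and "c < 1"
    and "real (Max (s ` verts G)) \<le> (1 - c) * ln (real (min_degree G))"
  shows "real (rs_domination_number G r s)
    < (ln (real (min_degree G)) / (real (min_degree G) + 1)
        + real (Max (s ` verts G)) / real (min_degree G) powr (0.5 * c\<^sup>2))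
      * real (card (verts G))"
proof -
  interpret graph G by fact
  define V where "V = verts G"
  define d where "d = min_degree G"
  define k where "k = Max (s ` V)"
  define m where "m = d + 1"
  define p where "p = ln (real d) / real m"
  have V: "finite V" "0 < card V"
    using assms(2) by (auto simp: V_def card_gt_0_iff)
  have d: "1 < real d" and ln_d: "0 < ln (real d)"
    using assms(3) by (auto simp: d_def)
  have ln_d_le: "ln (real d) \<le> real m"
    using ln_le_minus_one[of "real d"] d by (simp add: m_def)
  have k: "real k \<le> (1 - c) * ln (real d)"
    using assms(7) by (simp add: k_def V_def d_def)
  have s: "s v \<le> k" if "v \<in> V" for v
    using V that by (simp add: k_def)
  have m: "m \<le> card (closed_nbhd G v)" if "v \<in> V" for v
    using that by (auto simp: m_def d_def V_def card_closed_nbhd min_degree_def)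
  have "real k \<le> ln (real d) - c * ln (real d)"
    using k by (simp add: left_diff_distrib)
  then have km: "k \<le> m"
    using ln_d_le mult_pos_pos[OF assms(5) ln_d] by linarith
  have p: "0 < p" "p \<le> 1"
    using ln_d ln_d_le by (auto simp: p_def m_def field_simps)
  have "real (rs_domination_number G r s)
      < (p + real k / real d powr (c\<^sup>2 / 2)) * real (card V)"
  proof (cases "k = 0")
    case True
    then have "rs_domination_number G r s \<le> card ({} :: 'a set)"
      using s assms(4) by (intro rs_domination_number_le_card) (auto simp: V_def)
    then show ?thesis
      using True p V by simp
  next
    case False
    have q: "0 < 1 - c" "1 - c \<le> 1"
      using assms(5,6) by auto
    have nbhd: "closed_nbhd G v \<subseteq> V" if "v \<in> V" for v
      using closed_nbhd_subset that by (simp add: V_def)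
    obtain D where D: "D \<subseteq> V" "\<forall>v\<in>V. s v \<le> card (D \<inter> closed_nbhd G v)"
        "real (card D) \<le> (p + real k / (1 - c) ^ k * (1 - (1 - (1 - c)) * p) ^ m) * real (card V)"
      by (rule multiple_hitting_set_exists[OF V(1) nbhd m s km less_imp_le[OF p(1)] p(2) q])
    have "real k / (1 - c) ^ k * (1 - (1 - (1 - c)) * p) ^ m
        = real k * ((1 - c * (ln (real d) / real m)) ^ m / (1 - c) ^ k)"
      by (simp add: p_def)
    also have "\<dots> < real k * (1 / real d powr (c\<^sup>2 / 2))"
      using False ln_d_le
      by (intro mult_strict_left_mono chernoff_factor_less assms d k) (auto simp: m_def)
    finally have "(p + real k / (1 - c) ^ k * (1 - (1 - (1 - c)) * p) ^ m) * real (card V)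
        < (p + real k / real d powr (c\<^sup>2 / 2)) * real (card V)"
      using V(2) by (intro mult_strict_right_mono) simp_all
    moreover note D(3)
    moreover have "rs_domination_number G r s \<le> card D"
      using D(1,2) assms(4) by (intro rs_domination_number_le_card) (auto simp: V_def)
    ultimately show ?thesis by linarith
  qed
  then show ?thesis
    by (simp add: p_def m_def k_def V_def d_def add.commute)
qed

end
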